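(* Let $A\in\mathbb{Z}_{\max}^{n\times n}$, $C\in\mathbb{Z}_{\max}^{q\times n}$ and $\mathcal{V}=\ker E$, where $E\in\mathbb{Z}_{\max}^{p\times n}$ is a matrix with finite volume. Then the minimal (smallest) element $\mathcal{V}_{\rm fg}(C,A)$ of $\mathscr{L}_{\rm fg}(C,A,\mathcal{V})$ exists. Moreover, if we define a sequence of semimodules by $\mathcal{X}_1:=\mathcal{V}^\top$ and $$\mathcal{X}_{k+1}:=\mathcal{V}^\top\cap (A^t)^{-1}(\mathcal{X}_k\oplus\operatorname{Im}C^t)\quad (k\ge 1),$$ then $\mathcal{V}_{\rm fg}(C,A)=\mathcal{X}_r^\bot$ for some $r\le \operatorname{vol}(E)+1$.
   Context: $\mathbb{Z}_{\max}=\mathbb{Z}\cup\{-\infty\}$ is the semiring with addition $a\oplus b=\max(a,b)$ and multiplication $ab=a+b$ (a subsemiring of the max-plus semiring $\mathbb{R}\cup\{-\infty\}$). Operations extend to matrices as usual: $(E\oplus F)_{ij}=E_{ij}\oplus F_{ij}$, $(EF)_{ij}=\bigoplus_k E_{ik}F_{kj}$; $E^t$ is the transpose. All vectors, matrices, semimodules and congruences below are over $\mathbb{Z}_{\max}$. A semimodule is a (nonempty) subset of $\mathbb{Z}_{\max}^n$ stable under all linear combinations $\lambda x\oplus\mu y$. A congruence on $\mathbb{Z}_{\max}^n$ is an equivalence relation $\mathcal{W}\subset(\mathbb{Z}_{\max}^n)^2$ which is also a subsemimodule of $(\mathbb{Z}_{\max}^n)^2$. For a matrix $E$, $\operatorname{Im}E=\{Ex\}$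 and $\ker E=\{(x,y): Ex=Ey\}$. For a congruence $\mathcal{W}$, $A\mathcal{W}=\{(Ax,Ay):(x,y)\in\mathcal{W}\}$; for a set $\mathcal{S}$ of vectors, $A^{-1}\mathcal{S}=\{x: Ax\in\mathcal{S}\}$ (preimage). $\mathcal{X}\oplus\mathcal{Y}=\{x\oplus y: x\in\mathcal{X},y\in\mathcal{Y}\}$. Orthogonals: $\mathcal{X}^\bot=\{(x,y): x^tz=y^tz\ \forall z\in\mathcal{X}\}$ for a semimodule $\mathcal{X}$, and $\mathcal{W}^\top=\{z: x^tz=y^tz\ \forall (x,y)\in\mathcal{W}\}$ for a congruence $\mathcal{W}$. A congruence $\mathcal{W}$ is $(C,A)$-conditioned invariant if $A(\mathcal{W}\cap\ker C)\subset\mathcal{W}$. $\mathscr{L}_{\rm fg}(C,A,\mathcal{V})$ is the set of all $(C,A)$-conditioned invariant congruences that contain $\mathcal{V}$ and are of the form $\ker D$ for some matrix $D$, ordered by inclusion. Volume: for a semimodule $\mathcal{K}\subset\mathbb{Z}_{\max}^n$, $\operatorname{vol}(\mathcal{K})$ is the cardinality of $\{z\in\mathcal{K}: z_1\oplus\cdots\oplus z_n=0\}$ (here $0$ is the integer zero, i.e. the multiplicative unit); for a matrix $E$, $\operatorname{vol}(E)=\operatorname{vol}(\operatorname{Im}E)$. *)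

theory Defs
  imports "Jordan_Normal_Form.Matrix" "HOL-Library.Set_Algebras"
begin

section \<open>The semiring of max-plus integers\<close>

datatype zmax = Minus_Inf | Fin int

instantiation zmax :: linorder
begin

fun less_eq_zmax :: "zmax \<Rightarrow> zmax \<Rightarrow> bool" where
  "Minus_Inf \<le> b = True"
| "Fin i \<le> Minus_Inf = False"
| "Fin i \<le> Fin j = (i \<le> j)"

definition less_zmax :: "zmax \<Rightarrow> zmax \<Rightarrow> bool" where
  "less_zmax a b \<longleftrightarrow> a \<le> b \<and> \<not> b \<le> a"

instance
proof
  fix x y z :: zmax
  show "x < y \<longleftrightarrow> x \<le> y \<and> \<not> y \<le> x" by (rule less_zmax_def)
  show "x \<le> x" by (cases x) auto
  show "x \<le> y \<Longrightarrow> y \<le> z \<Longrightarrow> x \<le> z" by (cases x; cases y; cases z) auto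
  show "x \<le> y \<Longrightarrow> y \<le> x \<Longrightarrow> x = y" by (cases x; cases y) auto
  show "x \<le> y \<or> y \<le> x" by (cases x; cases y) auto
qed

end

text \<open>
  From here on \<open>+\<close> and \<open>*\<close> on \<open>zmax\<close> are the tropical operations. In particular \<open>0 :: zmax\<close>
  is \<open>Minus_Inf\<close>, while the integer zero \<open>Fin 0\<close> is \<open>1 :: zmax\<close>. The matrix library is generic
  over semirings, so products of matrices and vectors over \<open>zmax\<close> are the max-plus ones.
\<close>

instantiation zmax :: comm_semiring_1
begin

definition zero_zmax :: zmax where "0 = Minus_Inf"
definition one_zmax :: zmax where "1 = Fin 0"
definition plus_zmax :: "zmax \<Rightarrow> zmax \<Rightarrow> zmax" where "(a :: zmax) + b = max a b"

fun times_zmax :: "zmax \<Rightarrow> zmax \<Rightarrow> zmax" where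
  "Minus_Inf * b = Minus_Inf"
| "Fin i * Minus_Inf = Minus_Inf"
| "Fin i * Fin j = Fin (i + j)"

instance
proof
  fix a b c :: zmax
  show "a * b * c = a * (b * c)" by (cases a; cases b; cases c) auto
  show "a * b = b * a" by (cases a; cases b) auto
  show "1 * a = a" by (cases a) (auto simp: one_zmax_def)
  show "a + b + c = a + (b + c)" by (simp add: plus_zmax_def max.assoc)
  show "a + b = b + a" by (simp add: plus_zmax_def max.commute)
  show "0 + a = a" by (simp add: plus_zmax_def zero_zmax_def max_def)
  show "(a + b) * c = a * c + b * c"
    by (cases a; cases b; cases c) (auto simp: plus_zmax_def max_def)
  show "0 * a = 0" by (simp add: zero_zmax_def)
  show "a * 0 = 0" by (cases a) (auto simp: zero_zmax_def)
  show "(0 :: zmax) \<noteq> 1" by (simp add: zero_zmax_def one_zmax_def)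
qed

end


section \<open>Images, kernels and congruences\<close>

definition mat_Im :: "zmax mat \<Rightarrow> zmax vec set" where
  "mat_Im E = {E *\<^sub>v x | x. x \<in> carrier_vec (dim_col E)}"

definition mat_ker :: "zmax mat \<Rightarrow> (zmax vec \<times> zmax vec) set" where
  "mat_ker E = {(x, y). x \<in> carrier_vec (dim_col E) \<and> y \<in> carrier_vec (dim_col E)
                    \<and> E *\<^sub>v x = E *\<^sub>v y}"

definition congruence :: "nat \<Rightarrow> (zmax vec \<times> zmax vec) set \<Rightarrow> bool" where
  "congruence n W \<longleftrightarrow>
     equiv (carrier_vec n) W \<and>
     (\<forall>(x, y) \<in> W. \<forall>(x', y') \<in> W. \<forall>l m :: zmax.
        (l \<cdot>\<^sub>v x + m \<cdot>\<^sub>v x', l \<cdot>\<^sub>v y + m \<cdot>\<^sub>v y') \<in> W)"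

definition mat_image_rel :: "zmax mat \<Rightarrow> (zmax vec \<times> zmax vec) set \<Rightarrow> (zmax vec \<times> zmax vec) set"
  where "mat_image_rel A W = {(A *\<^sub>v x, A *\<^sub>v y) | x y. (x, y) \<in> W}"

definition mat_preimage :: "zmax mat \<Rightarrow> zmax vec set \<Rightarrow> zmax vec set" where
  "mat_preimage A S = {x \<in> carrier_vec (dim_col A). A *\<^sub>v x \<in> S}"

definition orth_bot :: "nat \<Rightarrow> zmax vec set \<Rightarrow> (zmax vec \<times> zmax vec) set" where
  "orth_bot n X = {(x, y). x \<in> carrier_vec n \<and> y \<in> carrier_vec n
                           \<and> (\<forall>z \<in> X. x \<bullet> z = y \<bullet> z)}"

definition orth_top :: "nat \<Rightarrow> (zmax vec \<times> zmax vec) set \<Rightarrow> zmax vec set" where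
  "orth_top n W = {z \<in> carrier_vec n. \<forall>(x, y) \<in> W. x \<bullet> z = y \<bullet> z}"


section \<open>Conditioned invariance\<close>

definition conditioned_invariant ::
    "zmax mat \<Rightarrow> zmax mat \<Rightarrow> (zmax vec \<times> zmax vec) set \<Rightarrow> bool" where
  "conditioned_invariant C A W \<longleftrightarrow> mat_image_rel A (W \<inter> mat_ker C) \<subseteq> W"

definition L_fg :: "nat \<Rightarrow> zmax mat \<Rightarrow> zmax mat \<Rightarrow> (zmax vec \<times> zmax vec) set
                     \<Rightarrow> (zmax vec \<times> zmax vec) set set" where
  "L_fg n C A V = {W. congruence n W \<and> conditioned_invariant C A W \<and> V \<subseteq> W
                      \<and> (\<exists>m D. D \<in> carrier_mat m n \<and> W = mat_ker D)}"


section \<open>Volume\<close>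

definition normalized_part :: "zmax vec set \<Rightarrow> zmax vec set" where
  "normalized_part K = {z \<in> K. (\<Sum>i<dim_vec z. z $ i) = 1}"

text \<open>Since \<open>card\<close> is \<open>0\<close> on infinite sets, \<open>vol\<close> is meaningful only under \<open>finite_volume\<close>.\<close>

definition finite_volume :: "zmax vec set \<Rightarrow> bool" where
  "finite_volume K \<longleftrightarrow> finite (normalized_part K)"

definition vol :: "zmax vec set \<Rightarrow> nat" where
  "vol K = card (normalized_part K)"

end

theory Submission
  imports Defs
begin

text \<open>
  By duality, \<open>(ker D)\<^sup>\<top> = Im D\<^sup>t\<close> and \<open>(Im D\<^sup>t)\<^sup>\<bottom> = ker D\<close>. Hence \<open>ker D\<close> is conditioned invariant
  and contains \<open>V\<close> exactly when \<open>Y = Im D\<^sup>t\<close> satisfies \<open>Y \<subseteq> V\<^sup>\<top>\<close> and \<open>A\<^sup>t Y \<subseteq> Y + Im C\<^sup>t\<close>, and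
  every such \<open>Y\<close> lies in all the \<open>X k\<close>. The \<open>X k\<close> decrease inside \<open>V\<^sup>\<top> = Im E\<^sup>t\<close>, whose volume is
  at most that of \<open>Im E\<close>, and a semimodule is determined by its normalised vectors; so the sequence
  becomes stationary after at most \<open>vol E + 1\<close> steps, at a finitely generated semimodule, which
  is then the largest such \<open>Y\<close>. For the comparison of volumes, finite volume forces all nonzero
  columns of \<open>E\<close> to have the same support, and then \<open>w \<mapsto> E (- w)\<close> is injective on the row space.
\<close>

section \<open>Arithmetic of max-plus integers\<close>

lemma zmax_zero_le [simp]: "(0 :: zmax) \<le> a"
  by (simp add: zero_zmax_def)

lemma zmax_le_zero_iff [simp]: "a \<le> (0 :: zmax) \<longleftrightarrow> a = 0"
  by (cases a) (auto simp: zero_zmax_def)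

lemma zmax_add_eq_left: "(b :: zmax) \<le> a \<Longrightarrow> a + b = a"
  by (simp add: plus_zmax_def max_def)

lemma zmax_mult_eq_zero_iff [simp]: "(a :: zmax) * b = 0 \<longleftrightarrow> a = 0 \<or> b = 0"
  by (cases a; cases b) (auto simp: zero_zmax_def)

lemma zmax_mult_right_cancel: "(c :: zmax) \<noteq> 0 \<Longrightarrow> a * c = b * c \<longleftrightarrow> a = b"
  by (cases a; cases b; cases c) (auto simp: zero_zmax_def)

lemma zmax_mult_left_mono: "(a :: zmax) \<le> b \<Longrightarrow> c * a \<le> c * b"
  by (cases a; cases b; cases c) auto

lemma zmax_sum_le_iff:
  "finite S \<Longrightarrow> sum f S \<le> (b :: zmax) \<longleftrightarrow> (\<forall>i\<in>S. f i \<le> b)"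
  by (induction S rule: finite_induct) (auto simp: plus_zmax_def)

lemma zmax_le_sum: "finite S \<Longrightarrow> i \<in> S \<Longrightarrow> f i \<le> (sum f S :: zmax)"
  using zmax_sum_le_iff[of S f "sum f S"] by simp

text \<open>A tropical sum is a maximum, hence attained by one of its terms; a nonzero value rules
  out the empty sum, which has no index to offer.\<close>

lemma zmax_sum_attained:
  assumes "finite S" "(sum f S :: zmax) \<noteq> 0"
  shows "\<exists>i\<in>S. sum f S = f i"
  using assms
proof (induction S rule: finite_induct)
  case (insert x S)
  then show ?case
    by (cases "sum f S = 0") (auto simp: plus_zmax_def max_def)
qed simp

text \<open>Multiplicative inverse, extended by sending \<open>Minus_Inf\<close> to itself since +
  infinity is not in the type. It stays multiplicative and preserves supports, but reverses the
  order only between finite values.\<close>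

fun zinv :: "zmax \<Rightarrow> zmax" where
  "zinv Minus_Inf = Minus_Inf"
| "zinv (Fin i) = Fin (- i)"

lemma zinv_zero [simp]: "zinv 0 = 0"
  by (simp add: zero_zmax_def)

lemma zinv_eq_zero_iff [simp]: "zinv a = 0 \<longleftrightarrow> a = 0"
  by (cases a) (auto simp: zero_zmax_def)

lemma zinv_mult: "zinv (a * b) = zinv a * zinv b"
  by (cases a; cases b) auto

lemma zinv_left: "a \<noteq> 0 \<Longrightarrow> zinv a * a = 1"
  by (cases a) (auto simp: zero_zmax_def one_zmax_def)

lemma zinv_left_le: "zinv a * a \<le> 1"
  by (cases a) (auto simp: one_zmax_def)


section \<open>Semimodules\<close>

text \<open>Nonemptiness is expressed by the zero vector, which is the multiple by \<open>0\<close>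
  of any element.\<close>

definition semimodule :: "nat \<Rightarrow> zmax vec set \<Rightarrow> bool" where
  "semimodule n K \<longleftrightarrow> K \<subseteq> carrier_vec n \<and> 0\<^sub>v n \<in> K
     \<and> (\<forall>x\<in>K. \<forall>y\<in>K. x + y \<in> K) \<and> (\<forall>x\<in>K. \<forall>c. c \<cdot>\<^sub>v x \<in> K)"

lemma semimoduleD:
  assumes "semimodule n K"
  shows "x \<in> K \<Longrightarrow> x \<in> carrier_vec n"
    and "0\<^sub>v n \<in> K"
    and "x \<in> K \<Longrightarrow> y \<in> K \<Longrightarrow> x + y \<in> K"
    and "x \<in> K \<Longrightarrow> c \<cdot>\<^sub>v x \<in> K"
  using assms unfolding semimodule_def by auto

lemma semimodule_Int: "semimodule n K \<Longrightarrow> semimodule n L \<Longrightarrow> semimodule n (K \<inter> L)"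
  unfolding semimodule_def by auto

section \<open>Matrix products and closure properties of semimodules\<close>

lemma mult_mat_vec_nth:
  assumes "A \<in> carrier_mat m n" "v \<in> carrier_vec n" "i < m"
  shows "(A *\<^sub>v v) $ i = (\<Sum>j<n. A $$ (i, j) * v $ j)"
  using assms by (auto simp: scalar_prod_def lessThan_atLeast0 intro!: sum.cong)

lemma scalar_prod_nth:
  assumes "w \<in> carrier_vec n"
  shows "v \<bullet> w = (\<Sum>j<n. v $ j * w $ j)"
  using assms by (simp add: scalar_prod_def lessThan_atLeast0)

lemma mult_mat_vec_smult:
  fixes A :: "zmax mat"
  assumes "A \<in> carrier_mat m n" "v \<in> carrier_vec n"
  shows "A *\<^sub>v (c \<cdot>\<^sub>v v) = c \<cdot>\<^sub>v (A *\<^sub>v v)"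
  using assms by (intro eq_vecI) auto

lemma mult_mat_vec_zero:
  fixes A :: "zmax mat"
  assumes "A \<in> carrier_mat m n"
  shows "A *\<^sub>v 0\<^sub>v n = 0\<^sub>v m"
  using assms by (intro eq_vecI) auto

lemma mult_mat_vec_transpose:
  fixes A :: "zmax mat"
  assumes "A \<in> carrier_mat m n" "x \<in> carrier_vec n" "y \<in> carrier_vec m"
  shows "(A *\<^sub>v x) \<bullet> y = x \<bullet> (transpose_mat A *\<^sub>v y)"
proof -
  have "(A *\<^sub>v x) \<bullet> y = y \<bullet> (A *\<^sub>v x)"
    using assms by (intro comm_scalar_prod[of _ m]) auto
  also have "\<dots> = (transpose_mat A *\<^sub>v y) \<bullet> x"
    using transpose_vec_mult_scalar[OF assms] by simp
  also have "\<dots> = x \<bullet> (transpose_mat A *\<^sub>v y)"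
    using assms by (intro comm_scalar_prod[of _ n]) auto
  finally show ?thesis .
qed

lemma semimodule_mat_Im:
  assumes E: "E \<in> carrier_mat m n"
  shows "semimodule m (mat_Im E)"
proof -
  have "E *\<^sub>v x + E *\<^sub>v y \<in> mat_Im E" if "x \<in> carrier_vec n" "y \<in> carrier_vec n" for x y
    using that E mult_add_distrib_mat_vec[OF E that]
    unfolding mat_Im_def by (auto intro!: exI[of _ "x + y"])
  moreover have "c \<cdot>\<^sub>v (E *\<^sub>v x) \<in> mat_Im E" if "x \<in> carrier_vec n" for x c
    using that E mult_mat_vec_smult[OF E that, of c]
    unfolding mat_Im_def by (auto intro!: exI[of _ "c \<cdot>\<^sub>v x"])
  moreover have "0\<^sub>v m \<in> mat_Im E"
    using E mult_mat_vec_zero[OF E] unfolding mat_Im_def by (auto intro!: exI[of _ "0\<^sub>v n"])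
  ultimately show ?thesis
    using E unfolding semimodule_def by (auto simp: mat_Im_def)
qed

lemma semimodule_plus:
  assumes K: "semimodule n K" and L: "semimodule n L"
  shows "semimodule n (K + L)"
proof -
  have "(x + y) + (x' + y') \<in> K + L" if "x \<in> K" "y \<in> L" "x' \<in> K" "y' \<in> L" for x y x' y'
  proof -
    have "(x + y) + (x' + y') = (x + x') + (y + y')"
      using semimoduleD(1)[OF K \<open>x \<in> K\<close>] semimoduleD(1)[OF K \<open>x' \<in> K\<close>]
        semimoduleD(1)[OF L \<open>y \<in> L\<close>] semimoduleD(1)[OF L \<open>y' \<in> L\<close>]
      by (intro eq_vecI) (auto simp: add.assoc add.left_commute)
    then show ?thesis
      using that K L by (auto simp: set_plus_def dest: semimoduleD(3))
  qed
  moreover have "c \<cdot>\<^sub>v (x + y) \<in> K + L" if "x \<in> K" "y \<in> L" for c x y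
  proof -
    have "c \<cdot>\<^sub>v (x + y) = c \<cdot>\<^sub>v x + c \<cdot>\<^sub>v y"
      using that K L by (intro eq_vecI) (auto simp: distrib_left dest!: semimoduleD(1))
    then show ?thesis
      using that K L by (auto simp: set_plus_def dest: semimoduleD(4))
  qed
  moreover have "0\<^sub>v n \<in> K + L"
    using semimoduleD(2)[OF K] semimoduleD(2)[OF L]
    by (auto simp: set_plus_def intro!: bexI[of _ "0\<^sub>v n"])
  moreover have "K + L \<subseteq> carrier_vec n"
    using K L by (auto simp: set_plus_def dest!: semimoduleD(1))
  ultimately show ?thesis
    unfolding semimodule_def by (auto elim!: set_plus_elim)
qed

lemma semimodule_mat_preimage:
  assumes A: "A \<in> carrier_mat m n" and K: "semimodule m K"
  shows "semimodule n (mat_preimage A K)"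
  using A mult_mat_vec_zero[OF A] semimoduleD(2-4)[OF K]
  unfolding semimodule_def mat_preimage_def
  by (auto simp: mult_add_distrib_mat_vec[OF A] mult_mat_vec_smult[OF A])


section \<open>Normalisation and volume\<close>

definition vec_total :: "zmax vec \<Rightarrow> zmax" where
  "vec_total v = (\<Sum>i<dim_vec v. v $ i)"

lemma vec_total_smult: "vec_total (c \<cdot>\<^sub>v v) = c * vec_total v"
  by (simp add: vec_total_def sum_distrib_left)

lemma vec_total_eq_zero_iff:
  assumes "v \<in> carrier_vec n"
  shows "vec_total v = 0 \<longleftrightarrow> v = 0\<^sub>v n"
proof -
  have "vec_total v = 0 \<longleftrightarrow> vec_total v \<le> 0" by simp
  also have "\<dots> \<longleftrightarrow> (\<forall>i<n. v $ i = 0)"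
    using assms by (simp add: vec_total_def zmax_sum_le_iff Ball_def del: zmax_le_zero_iff) simp
  also have "\<dots> \<longleftrightarrow> v = 0\<^sub>v n" using assms by auto
  finally show ?thesis .
qed

lemma in_normalized_part_iff: "v \<in> normalized_part K \<longleftrightarrow> v \<in> K \<and> vec_total v = 1"
  by (simp add: normalized_part_def vec_total_def)

definition normalize_vec :: "zmax vec \<Rightarrow> zmax vec" where
  "normalize_vec v = zinv (vec_total v) \<cdot>\<^sub>v v"

lemma normalize_vec_in_normalized_part:
  assumes K: "semimodule n K" and "v \<in> K" "v \<noteq> 0\<^sub>v n"
  shows "normalize_vec v \<in> normalized_part K"
proof -
  have "vec_total v \<noteq> 0"
    using assms vec_total_eq_zero_iff semimoduleD(1)[OF K] by blast
  then show ?thesis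
    using semimoduleD(4)[OF K \<open>v \<in> K\<close>]
    by (simp add: in_normalized_part_iff normalize_vec_def vec_total_smult zinv_left)
qed

lemma normalize_vec_smult:
  assumes "v \<in> carrier_vec n" "v \<noteq> 0\<^sub>v n"
  shows "v = vec_total v \<cdot>\<^sub>v normalize_vec v"
proof -
  have "vec_total v \<noteq> 0" using assms vec_total_eq_zero_iff by blast
  then have "vec_total v * (zinv (vec_total v) * a) = a" for a
    by (metis zinv_left mult.assoc mult.commute mult_1)
  then show ?thesis
    by (intro eq_vecI) (auto simp: normalize_vec_def)
qed

lemma normalize_vec_eqD:
  assumes "u \<in> carrier_vec n" "u \<noteq> 0\<^sub>v n" "v \<in> carrier_vec n" "v \<noteq> 0\<^sub>v n"
    and "normalize_vec u = normalize_vec v"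
  shows "\<exists>c. u = c \<cdot>\<^sub>v v"
proof -
  have "u = vec_total u \<cdot>\<^sub>v (zinv (vec_total v) \<cdot>\<^sub>v v)"
    using normalize_vec_smult[of u n] assms by (simp add: normalize_vec_def)
  also have "\<dots> = (vec_total u * zinv (vec_total v)) \<cdot>\<^sub>v v"
    by (intro eq_vecI) (auto simp: mult.assoc)
  finally show ?thesis ..
qed

text \<open>Every nonzero vector is a multiple of its normalisation. Strict inclusions of
  semimodules thus become strict inclusions of sets that can be counted.\<close>

lemma semimodule_eqI:
  assumes K: "semimodule n K" and L: "semimodule n L"
    and "L \<subseteq> K" and "normalized_part K \<subseteq> normalized_part L"
  shows "K = L"
proof
  show "K \<subseteq> L"
  proof
    fix v assume v: "v \<in> K"
    show "v \<in> L"
    proof (cases "v = 0\<^sub>v n")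
      case True
      then show ?thesis using semimoduleD(2)[OF L] by simp
    next
      case False
      then have "normalize_vec v \<in> L"
        using normalize_vec_in_normalized_part[OF K v] assms(4) by (auto simp: in_normalized_part_iff)
      then show ?thesis
        using normalize_vec_smult[OF semimoduleD(1)[OF K v] False] semimoduleD(4)[OF L] by metis
    qed
  qed
qed fact

text \<open>If \<open>u k = 0 \<noteq> v k\<close>, the vectors \<open>u + t v\<close> for small \<open>t\<close> are pairwise non-proportional,
  which gives infinitely many normalised vectors.\<close>

lemma finite_volume_support:
  assumes K: "semimodule n K" and fin: "finite_volume K"
    and u: "u \<in> K" "a < n" "u $ a \<noteq> 0" and v: "v \<in> K" "k < n" "v $ k \<noteq> 0"
  shows "u $ k \<noteq> 0"
proof
  assume uk: "u $ k = 0"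
  have uc: "u \<in> carrier_vec n" and vc: "v \<in> carrier_vec n"
    using semimoduleD(1)[OF K] u v by auto
  \<comment> \<open>Below the level \<open>B\<close> the multiples of \<open>v\<close> no longer
    show in entry \<open>a\<close>, so all \<open>f m\<close> agree there.\<close>
  obtain B where B: "\<And>m. Fin (B - int m) * v $ a \<le> u $ a"
  proof (cases "v $ a")
    case Minus_Inf
    then show thesis using that[of 0] by simp
  next
    case (Fin b)
    moreover obtain c where "u $ a = Fin c"
      using u(3) by (cases "u $ a") (auto simp: zero_zmax_def)
    ultimately show thesis using that[of "c - b"] by simp
  qed
  define f where "f m = u + Fin (B - int m) \<cdot>\<^sub>v v" for m
  have f_in: "f m \<in> K" for m
    using u v K by (auto simp: f_def intro!: semimoduleD(3,4))
  have fa: "f m $ a = u $ a" for m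
    using uc vc u(2) B by (simp add: f_def zmax_add_eq_left)
  have fk: "f m $ k = Fin (B - int m) * v $ k" for m
    using uc vc v(2) uk by (simp add: f_def)
  have f_nz: "f m \<noteq> 0\<^sub>v n" for m
    using fa[of m] u(2,3) by auto
  have "inj (\<lambda>m. normalize_vec (f m))"
  proof (rule injI)
    fix m m' assume "normalize_vec (f m) = normalize_vec (f m')"
    then obtain c where c: "f m = c \<cdot>\<^sub>v f m'"
      using normalize_vec_eqD f_in f_nz semimoduleD(1)[OF K] by metis
    have dim: "dim_vec (f m') = n"
      using semimoduleD(1)[OF K f_in[of m']] by auto
    \<comment> \<open>Entry \<open>a\<close> forces the proportionality factor to be
      \<open>1\<close>; entry \<open>k\<close>, where \<open>u\<close> contributes nothing, then
      recovers \<open>m\<close>.\<close>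
    have "1 * u $ a = c * u $ a"
      using arg_cong[OF c, of "\<lambda>x. x $ a"] fa u(2) dim by simp
    then have "c = 1"
      using u(3) zmax_mult_right_cancel by metis
    then have "Fin (B - int m) * v $ k = Fin (B - int m') * v $ k"
      using arg_cong[OF c, of "\<lambda>x. x $ k"] fk v(2) dim by simp
    then show "m = m'"
      using v(3) by (simp add: zmax_mult_right_cancel)
  qed
  moreover have "range (\<lambda>m. normalize_vec (f m)) \<subseteq> normalized_part K"
    using normalize_vec_in_normalized_part[OF K f_in f_nz] by auto
  ultimately show False
    using fin finite_subset finite_imageD infinite_UNIV_nat unfolding finite_volume_def by metis
qed

section \<open>Residuation and comparison of column and row volumes\<close>

definition neg_vec :: "zmax vec \<Rightarrow> zmax vec" where
  "neg_vec v = vec (dim_vec v) (\<lambda>i. zinv (v $ i))"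

lemma neg_vec_carrier [simp]: "v \<in> carrier_vec n \<Longrightarrow> neg_vec v \<in> carrier_vec n"
  by (auto simp: neg_vec_def)

lemma neg_vec_nth [simp]: "i < dim_vec v \<Longrightarrow> neg_vec v $ i = zinv (v $ i)"
  by (simp add: neg_vec_def)

lemma dim_neg_vec [simp]: "dim_vec (neg_vec v) = dim_vec v"
  by (simp add: neg_vec_def)

lemma neg_vec_zero: "neg_vec (0\<^sub>v n) = 0\<^sub>v n"
  by (intro eq_vecI) auto

lemma neg_vec_smult: "neg_vec (c \<cdot>\<^sub>v v) = zinv c \<cdot>\<^sub>v neg_vec v"
  by (intro eq_vecI) (auto simp: zinv_mult)

text \<open>Residuation: when the finite entries of \<open>E\<close> form a rectangle, \<open>u \<mapsto> E\<^sup>t (- u)\<close> inverts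
  \<open>w \<mapsto> E (- w)\<close> on the row space.\<close>

lemma transpose_neg_mult_neg:
  assumes E: "E \<in> carrier_mat m n"
    and rect: "\<And>i j i' j'. i < m \<Longrightarrow> i' < m \<Longrightarrow> j < n \<Longrightarrow> j' < n \<Longrightarrow>
                 E $$ (i, j) \<noteq> 0 \<Longrightarrow> E $$ (i', j') \<noteq> 0 \<Longrightarrow> E $$ (i, j') \<noteq> 0"
    and w: "w \<in> mat_Im (transpose_mat E)"
  shows "transpose_mat E *\<^sub>v neg_vec (E *\<^sub>v neg_vec w) = w"
proof -
  have ET: "transpose_mat E \<in> carrier_mat n m" using E by simp
  obtain l where l: "l \<in> carrier_vec m" and wl: "w = transpose_mat E *\<^sub>v l"
    using w E unfolding mat_Im_def by auto
  have wc: "w \<in> carrier_vec n" using ET l wl by simp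
  have w_nth: "w $ j = (\<Sum>i<m. E $$ (i, j) * l $ i)" if "j < n" for j
    using mult_mat_vec_nth[OF ET l that] E that by (simp add: wl)
  define u where "u = E *\<^sub>v neg_vec w"
  have uc: "u \<in> carrier_vec m" using E wc by (simp add: u_def)
  have u_nth: "u $ i = (\<Sum>j<n. E $$ (i, j) * zinv (w $ j))" if "i < m" for i
    using mult_mat_vec_nth[OF E neg_vec_carrier[OF wc] that] wc by (simp add: u_def)
  have psi: "(transpose_mat E *\<^sub>v neg_vec u) $ j = (\<Sum>i<m. E $$ (i, j) * zinv (u $ i))" if "j < n" for j
    using mult_mat_vec_nth[OF ET neg_vec_carrier[OF uc] that] uc E that by simp
  show ?thesis
  proof (cases "w = 0\<^sub>v n")
    case True
    then show ?thesis
      using E by (simp add: neg_vec_zero mult_mat_vec_zero[OF E] mult_mat_vec_zero[OF ET])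
  next
    case False
    then obtain j0 where j0: "j0 < n" "w $ j0 \<noteq> 0"
      using wc by (auto simp: vec_eq_iff)
    then obtain i0 where i0: "i0 < m" "E $$ (i0, j0) \<noteq> 0" "l $ i0 \<noteq> 0"
      using zmax_sum_attained[of "{..<m}" "\<lambda>i. E $$ (i, j0) * l $ i"] w_nth[of j0] by auto
    \<comment> \<open>By the rectangle hypothesis, row \<open>i0\<close> is finite in every column
      of \<open>E\<close> that has a finite entry, so \<open>w\<close> is finite there. Hence an
      entry \<open>- infinity\<close> of \<open>w\<close>, where \<open>zinv\<close> is no true
      inverse, only meets a zero column.\<close>
    have supp: "w $ j \<noteq> 0" if "i < m" "j < n" "E $$ (i, j) \<noteq> 0" for i j
    proof -
      have "E $$ (i0, j) \<noteq> 0" using rect[of i0 i j0 j] that i0 j0 by auto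
      moreover have "E $$ (i0, j) * l $ i0 \<le> w $ j"
        using that i0 w_nth zmax_le_sum[of "{..<m}" i0 "\<lambda>i. E $$ (i, j) * l $ i"] by simp
      ultimately show ?thesis using i0 by auto
    qed
    have "(transpose_mat E *\<^sub>v neg_vec u) $ j = w $ j" if j: "j < n" for j
    proof (rule antisym)
      have "E $$ (i, j) * zinv (u $ i) \<le> w $ j" if i: "i < m" for i
      proof (cases "E $$ (i, j) = 0")
        case False
        have "E $$ (i, j) * zinv (w $ j) \<le> u $ i"
          using i j u_nth zmax_le_sum[of "{..<n}" j "\<lambda>j. E $$ (i, j) * zinv (w $ j)"] by simp
        with False supp[OF i j] show ?thesis
          by (cases "E $$ (i, j)"; cases "w $ j"; cases "u $ i") (auto simp: zero_zmax_def)
      qed simp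
      then show "(transpose_mat E *\<^sub>v neg_vec u) $ j \<le> w $ j"
        using psi[OF j] by (simp add: zmax_sum_le_iff)
    next
      show "w $ j \<le> (transpose_mat E *\<^sub>v neg_vec u) $ j"
      proof (cases "w $ j = 0")
        case False
        then obtain i where i: "i < m" "w $ j = E $$ (i, j) * l $ i"
          using zmax_sum_attained[of "{..<m}" "\<lambda>i. E $$ (i, j) * l $ i"] w_nth[OF j] by auto
        with False have nz: "E $$ (i, j) \<noteq> 0" "l $ i \<noteq> 0" by auto
        have "E $$ (i, j) * zinv (w $ j) \<le> u $ i"
          using i j u_nth zmax_le_sum[of "{..<n}" j "\<lambda>j. E $$ (i, j) * zinv (w $ j)"] by simp
        \<comment> \<open>Finiteness of \<open>u $ i\<close> is needed to reverse the bound by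
          \<open>zinv (l $ i)\<close> below.\<close>
        then have ui: "u $ i \<noteq> 0"
          using nz False by auto
        have "E $$ (i, j') * zinv (w $ j') \<le> zinv (l $ i)" if j': "j' < n" for j'
        proof -
          have "E $$ (i, j') * l $ i \<le> w $ j'"
            using i j' w_nth zmax_le_sum[of "{..<m}" i "\<lambda>i. E $$ (i, j') * l $ i"] by simp
          then show ?thesis using nz
            by (cases "E $$ (i, j')"; cases "w $ j'"; cases "l $ i") (auto simp: zero_zmax_def)
        qed
        then have "u $ i \<le> zinv (l $ i)"
          using u_nth[OF i(1)] by (simp add: zmax_sum_le_iff)
        then have "l $ i \<le> zinv (u $ i)"
          using ui nz by (cases "l $ i"; cases "u $ i") (auto simp: zero_zmax_def)
        then have "w $ j \<le> E $$ (i, j) * zinv (u $ i)"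
          using i zmax_mult_left_mono by simp
        also have "\<dots> \<le> (transpose_mat E *\<^sub>v neg_vec u) $ j"
          using i psi[OF j] zmax_le_sum[of "{..<m}" i "\<lambda>i. E $$ (i, j) * zinv (u $ i)"] by simp
        finally show ?thesis .
      qed simp
    qed
    then show ?thesis using E wc by (intro eq_vecI) (auto simp: u_def)
  qed
qed

text \<open>Normalising \<open>E (- w)\<close> keeps the map injective on normalised
  \<open>w\<close>: proportional images come from proportional vectors by
  \<open>transpose_neg_mult_neg\<close>, and proportional normalised vectors coincide.\<close>

lemma finite_volume_transpose:
  assumes E: "E \<in> carrier_mat m n" and fin: "finite_volume (mat_Im E)"
  shows "finite_volume (mat_Im (transpose_mat E))"
    and "vol (mat_Im (transpose_mat E)) \<le> vol (mat_Im E)"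
proof -
  have ET: "transpose_mat E \<in> carrier_mat n m" using E by simp
  note Im = semimodule_mat_Im[OF E]
  have col_in: "col E j \<in> mat_Im E" if "j < n" for j
  proof -
    have "col E j = E *\<^sub>v unit_vec n j"
      using E that by (intro eq_vecI) (auto simp: scalar_prod_right_unit)
    then show ?thesis using E unfolding mat_Im_def by auto
  qed
  \<comment> \<open>Column \<open>j'\<close> is nonzero because of row \<open>i'\<close>, so by
    \<open>finite_volume_support\<close> it is finite wherever column \<open>j\<close> is.\<close>
  have rect: "E $$ (i, j') \<noteq> 0"
    if "i < m" "i' < m" "j < n" "j' < n" "E $$ (i, j) \<noteq> 0" "E $$ (i', j') \<noteq> 0" for i j i' j'
    using finite_volume_support[OF Im fin col_in[of j'] \<open>i' < m\<close> _ col_in[of j] \<open>i < m\<close>] that E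
    by simp
  let ?N = "normalized_part (mat_Im (transpose_mat E))"
  let ?g = "\<lambda>w. normalize_vec (E *\<^sub>v neg_vec w)"
  have inv: "transpose_mat E *\<^sub>v neg_vec (E *\<^sub>v neg_vec w) = w" if "w \<in> ?N" for w
    using transpose_neg_mult_neg[OF E rect] that by (simp add: in_normalized_part_iff)
  have wc: "w \<in> carrier_vec n" if "w \<in> ?N" for w
    using that semimoduleD(1)[OF semimodule_mat_Im[OF ET]] by (auto simp: in_normalized_part_iff)
  have uc: "E *\<^sub>v neg_vec w \<in> carrier_vec m" if "w \<in> ?N" for w
    using E wc[OF that] by simp
  have nz: "E *\<^sub>v neg_vec w \<noteq> 0\<^sub>v m" if "w \<in> ?N" for w
  proof
    assume "E *\<^sub>v neg_vec w = 0\<^sub>v m"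
    then have "w = 0\<^sub>v n"
      using inv[OF that] by (simp add: neg_vec_zero mult_mat_vec_zero[OF ET])
    then have "vec_total w = 0" using vec_total_eq_zero_iff[OF wc[OF that]] by simp
    with that show False by (simp add: in_normalized_part_iff)
  qed
  have img: "?g ` ?N \<subseteq> normalized_part (mat_Im E)"
  proof clarify
    fix w assume w: "w \<in> ?N"
    have "E *\<^sub>v neg_vec w \<in> mat_Im E"
      using wc[OF w] E unfolding mat_Im_def by auto
    then show "?g w \<in> normalized_part (mat_Im E)"
      using normalize_vec_in_normalized_part[OF Im] nz[OF w] by simp
  qed
  have inj: "inj_on ?g ?N"
  proof (rule inj_onI)
    fix w w' assume w: "w \<in> ?N" and w': "w' \<in> ?N" and "?g w = ?g w'"
    then obtain c where c: "E *\<^sub>v neg_vec w = c \<cdot>\<^sub>v (E *\<^sub>v neg_vec w')"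
      using normalize_vec_eqD uc nz by metis
    have "w = transpose_mat E *\<^sub>v neg_vec (c \<cdot>\<^sub>v (E *\<^sub>v neg_vec w'))"
      using inv[OF w] c by simp
    also have "\<dots> = zinv c \<cdot>\<^sub>v w'"
      using mult_mat_vec_smult[OF ET neg_vec_carrier[OF uc[OF w']]] inv[OF w']
      by (simp add: neg_vec_smult)
    finally have ww: "w = zinv c \<cdot>\<^sub>v w'" .
    then have "zinv c = 1"
      using w w' vec_total_smult[of "zinv c" w'] by (simp add: in_normalized_part_iff)
    then show "w = w'" using ww by (intro eq_vecI) auto
  qed
  show "finite_volume (mat_Im (transpose_mat E))"
    using inj_on_finite[OF inj img] fin by (simp add: finite_volume_def)
  show "vol (mat_Im (transpose_mat E)) \<le> vol (mat_Im E)"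
    using card_inj_on_le[OF inj img] fin by (simp add: finite_volume_def vol_def)
qed


section \<open>Duality between kernels and row spaces\<close>

text \<open>In the main case \<open>l\<close> is the residual, the minimum of
  \<open>z j - d j\<close> over finite \<open>d j\<close>. An index attaining it is the witness for
  every \<open>k\<close> with slack. If a finite \<open>d j\<close> meets \<open>z j = 0\<close>,
  that \<open>j\<close> is the witness and \<open>l = 0\<close> works; \<open>l = 0\<close> also
  serves when all \<open>d j\<close> vanish. The lemma is applied to each row of
  \<open>E\<close>.\<close>

lemma zmax_residual:
  fixes d z :: "'a \<Rightarrow> zmax"
  assumes "finite S"
  shows "\<exists>l. (\<forall>j\<in>S. d j * l \<le> z j)
    \<and> (\<forall>k\<in>S. d k * l < z k \<longrightarrow> d k \<noteq> 0 \<longrightarrow>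
         (\<exists>j\<in>S. d j \<noteq> 0 \<and> (z j = 0 \<or> d k * zinv (z k) < d j * zinv (z j))))"
proof (cases "(\<exists>j\<in>S. d j \<noteq> 0 \<and> z j = 0) \<or> (\<forall>j\<in>S. d j = 0)")
  case True
  then show ?thesis by (intro exI[of _ 0]) auto
next
  case False
  let ?Q = "(\<lambda>j. z j * zinv (d j)) ` {j\<in>S. d j \<noteq> 0}"
  have fin: "finite ?Q" and ne: "?Q \<noteq> {}" using assms False by auto
  obtain j where j: "j \<in> S" "d j \<noteq> 0" "Min ?Q = z j * zinv (d j)"
    using Min_in[OF fin ne] by auto
  have zj: "z j \<noteq> 0" using False j by auto
  have "d i * Min ?Q \<le> z i" if i: "i \<in> S" for i
  proof (cases "d i = 0")
    case False
    then have "Min ?Q \<le> z i * zinv (d i)" using i fin by (intro Min_le) auto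
    with False show ?thesis
      by (cases "d i"; cases "z i"; cases "Min ?Q") (auto simp: zero_zmax_def)
  qed simp
  moreover have "d k * zinv (z k) < d j * zinv (z j)" if "d k * Min ?Q < z k" "d k \<noteq> 0" for k
    using that j(2) zj unfolding j(3)
    by (cases "d k"; cases "z k"; cases "d j"; cases "z j") (auto simp: zero_zmax_def less_zmax_def)
  ultimately show ?thesis using j by (intro exI[of _ "Min ?Q"]) blast
qed

text \<open>Finitely many quotients \<open>c p - d p\<close> have a common upper bound; this
  \<open>M\<close> stands in for + infinity in \<open>orth_top_mat_ker\<close>.\<close>

lemma zmax_common_multiplier:
  fixes c d :: "'a \<Rightarrow> zmax"
  assumes "finite S"
  shows "\<exists>M. \<forall>p\<in>S. d p \<noteq> 0 \<longrightarrow> c p \<le> d p * M"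
  using assms
proof (induction S rule: finite_induct)
  case (insert x S)
  then obtain M where M: "\<forall>p\<in>S. d p \<noteq> 0 \<longrightarrow> c p \<le> d p * M" by auto
  let ?M = "max M (zinv (d x) * c x)"
  have "c p \<le> d p * ?M" if "p \<in> S" "d p \<noteq> 0" for p
    using M that zmax_mult_left_mono[of M ?M "d p"] by (meson max.cobounded1 order_trans)
  moreover have "c x \<le> d x * ?M" if "d x \<noteq> 0"
  proof -
    have "c x = d x * (zinv (d x) * c x)"
      using zinv_left[OF that] by (metis mult.assoc mult.commute mult_1)
    also have "\<dots> \<le> d x * ?M" by (intro zmax_mult_left_mono) simp
    finally show ?thesis .
  qed
  ultimately show ?case by blast
qed simp

text \<open>The row-space vector \<open>E\<^sup>t l\<close> with residual coefficients \<open>l\<close> is the best approximation of \<open>z\<close>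
  from below. If it misses entry \<open>k\<close>, then \<open>x = - z\<close> (with \<open>+ \<infinity>\<close> replaced by a large \<open>M\<close>) can be
  increased at \<open>k\<close> by one unit above \<open>- z k\<close> without changing \<open>E x\<close>; but \<open>x \<bullet> z\<close> does change.\<close>

lemma orth_top_mat_ker:
  assumes E: "E \<in> carrier_mat m n"
  shows "orth_top n (mat_ker E) = mat_Im (transpose_mat E)"
proof
  have ET: "transpose_mat E \<in> carrier_mat n m" using E by simp
  show "mat_Im (transpose_mat E) \<subseteq> orth_top n (mat_ker E)"
  proof
    fix z assume "z \<in> mat_Im (transpose_mat E)"
    then obtain l where l: "l \<in> carrier_vec m" "z = transpose_mat E *\<^sub>v l"
      using E unfolding mat_Im_def by auto
    then show "z \<in> orth_top n (mat_ker E)"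
      using E unfolding orth_top_def mat_ker_def
      by (auto simp flip: mult_mat_vec_transpose[OF E])
  qed
  show "orth_top n (mat_ker E) \<subseteq> mat_Im (transpose_mat E)"
  proof
    fix z assume z: "z \<in> orth_top n (mat_ker E)"
    then have zc: "z \<in> carrier_vec n" by (simp add: orth_top_def)
    let ?Q = "\<lambda>i l. (\<forall>j\<in>{..<n}. E $$ (i, j) * l \<le> z $ j)
      \<and> (\<forall>k\<in>{..<n}. E $$ (i, k) * l < z $ k \<longrightarrow> E $$ (i, k) \<noteq> 0 \<longrightarrow>
         (\<exists>j\<in>{..<n}. E $$ (i, j) \<noteq> 0 \<and>
            (z $ j = 0 \<or> E $$ (i, k) * zinv (z $ k) < E $$ (i, j) * zinv (z $ j))))"
    have "\<forall>i. \<exists>l. ?Q i l"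
      by (intro allI zmax_residual) simp
    from choice[OF this] obtain l where l: "\<forall>i. ?Q i (l i)" ..
    have le: "E $$ (i, j) * l i \<le> z $ j" if "j < n" for i j
      using l that by simp
    have gap: "\<exists>j<n. E $$ (i, j) \<noteq> 0 \<and>
        (z $ j = 0 \<or> E $$ (i, k) * zinv (z $ k) < E $$ (i, j) * zinv (z $ j))"
      if "k < n" "E $$ (i, k) * l i < z $ k" "E $$ (i, k) \<noteq> 0" for i k
      using spec[OF l, of i] that by fastforce
    let ?l = "vec m l"
    have nth: "(transpose_mat E *\<^sub>v ?l) $ k = (\<Sum>i<m. E $$ (i, k) * l i)" if "k < n" for k
      using mult_mat_vec_nth[OF ET _ that, of ?l] E that by simp
    have "(transpose_mat E *\<^sub>v ?l) $ k = z $ k" if k: "k < n" for k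
    proof (rule ccontr)
      assume "(transpose_mat E *\<^sub>v ?l) $ k \<noteq> z $ k"
      moreover have "(transpose_mat E *\<^sub>v ?l) $ k \<le> z $ k"
        using le[OF k] by (simp add: nth[OF k] zmax_sum_le_iff)
      ultimately have lt: "(transpose_mat E *\<^sub>v ?l) $ k < z $ k" by simp
      have lt_i: "E $$ (i, k) * l i < z $ k" if "i < m" for i
        using lt zmax_le_sum[of "{..<m}" i "\<lambda>i. E $$ (i, k) * l i"] that nth[OF k]
        by (simp add: order_le_less_trans)
      have zk: "z $ k \<noteq> 0" using lt by (auto simp: not_le[symmetric])
      define t where "t = Fin 1 * zinv (z $ k)"
      obtain M where M: "\<And>i j. i < m \<Longrightarrow> j < n \<Longrightarrow> E $$ (i, j) \<noteq> 0 \<Longrightarrow> E $$ (i, k) * t \<le> E $$ (i, j) * M"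
        using zmax_common_multiplier[of "{..<m} \<times> {..<n}" "\<lambda>p. E $$ p" "\<lambda>p. E $$ (fst p, k) * t"] by auto
      define x where "x = vec n (\<lambda>j. if z $ j = 0 then M else zinv (z $ j))"
      define y where "y = x + t \<cdot>\<^sub>v unit_vec n k"
      have xc: "x \<in> carrier_vec n" and yc: "y \<in> carrier_vec n" by (auto simp: x_def y_def)
      have "E *\<^sub>v y = E *\<^sub>v x + t \<cdot>\<^sub>v (E *\<^sub>v unit_vec n k)"
        unfolding y_def using xc
        by (simp add: mult_add_distrib_mat_vec[OF E] mult_mat_vec_smult[OF E])
      also have "\<dots> = E *\<^sub>v x"
      proof (intro eq_vecI)
        fix i assume "i < dim_vec (E *\<^sub>v x)"
        then have i: "i < m" using E by simp
        have "E $$ (i, k) * t \<le> (E *\<^sub>v x) $ i"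
        proof (cases "E $$ (i, k) = 0")
          case False
          then obtain j where j: "j < n" "E $$ (i, j) \<noteq> 0"
            "z $ j = 0 \<or> E $$ (i, k) * zinv (z $ k) < E $$ (i, j) * zinv (z $ j)"
            using gap[OF k lt_i[OF i]] by auto
          have "E $$ (i, k) * t \<le> E $$ (i, j) * x $ j"
          proof (cases "z $ j = 0")
            case True
            then show ?thesis using M[OF i j(1,2)] j(1) by (simp add: x_def)
          next
            case nz: False
            then have "E $$ (i, k) * zinv (z $ k) < E $$ (i, j) * zinv (z $ j)" using j by simp
            \<comment> \<open>Integrality enters here: a strict inequality leaves room for a whole
              unit, which absorbs the increase at \<open>k\<close>.\<close>
            then have "Fin 1 * (E $$ (i, k) * zinv (z $ k)) \<le> E $$ (i, j) * zinv (z $ j)"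
              by (cases "E $$ (i, k) * zinv (z $ k)"; cases "E $$ (i, j) * zinv (z $ j)")
                (auto simp: less_zmax_def)
            then show ?thesis using nz j(1) by (simp add: x_def t_def mult.left_commute)
          qed
          also have "\<dots> \<le> (E *\<^sub>v x) $ i"
            using j(1) zmax_le_sum[of "{..<n}" j "\<lambda>j. E $$ (i, j) * x $ j"]
            by (simp add: mult_mat_vec_nth[OF E xc i] del: index_mult_mat_vec)
          finally show ?thesis .
        qed simp
        moreover have "(E *\<^sub>v unit_vec n k) $ i = E $$ (i, k)"
          using E i k by (simp add: scalar_prod_right_unit)
        ultimately show "(E *\<^sub>v x + t \<cdot>\<^sub>v (E *\<^sub>v unit_vec n k)) $ i = (E *\<^sub>v x) $ i"
          using E i by (simp add: zmax_add_eq_left mult.commute del: index_mult_mat_vec)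
      qed (use E in simp)
      finally have "(x, y) \<in> mat_ker E"
        using xc yc E by (simp add: mat_ker_def)
      with z have "x \<bullet> z = y \<bullet> z"
        unfolding orth_top_def by blast
      also have "y \<bullet> z = x \<bullet> z + t * z $ k"
        unfolding y_def using xc zc k
        by (subst add_scalar_prod_distrib[of _ n]) auto
      also have "t * z $ k = Fin 1"
        using zk by (cases "z $ k") (auto simp: t_def zero_zmax_def)
      \<comment> \<open>The increase adds the term \<open>Fin 1\<close> to the product with
        \<open>z\<close>, while every term of \<open>x \<bullet> z\<close> is at most
        \<open>1 = Fin 0\<close>: entries \<open>M\<close> of \<open>x\<close> meet only zeros of
        \<open>z\<close>.\<close>
      finally have "Fin 1 \<le> x \<bullet> z" by (simp add: plus_zmax_def max_def split: if_splits)
      moreover have "x \<bullet> z \<le> 1"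
        unfolding scalar_prod_nth[OF zc] by (auto simp: zmax_sum_le_iff x_def zinv_left_le)
      ultimately have "Fin 1 \<le> 1" by (rule order_trans)
      then show False by (simp add: one_zmax_def)
    qed
    then have "z = transpose_mat E *\<^sub>v ?l" using E zc by (intro eq_vecI) auto
    then show "z \<in> mat_Im (transpose_mat E)" using E unfolding mat_Im_def by auto
  qed
qed

text \<open>One inclusion follows from \<open>orth_top_mat_ker\<close>; the other tests against the
  rows of \<open>D\<close>, which are the images of unit vectors under the transpose.\<close>

lemma orth_bot_mat_Im:
  assumes D: "D \<in> carrier_mat m n"
  shows "orth_bot n (mat_Im (transpose_mat D)) = mat_ker D"
proof
  show "mat_ker D \<subseteq> orth_bot n (mat_Im (transpose_mat D))"
    unfolding orth_top_mat_ker[OF D, symmetric]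
    using D by (auto simp: orth_bot_def orth_top_def mat_ker_def)
  show "orth_bot n (mat_Im (transpose_mat D)) \<subseteq> mat_ker D"
  proof clarify
    fix x y assume xy: "(x, y) \<in> orth_bot n (mat_Im (transpose_mat D))"
    then have c: "x \<in> carrier_vec n" "y \<in> carrier_vec n" by (auto simp: orth_bot_def)
    have "(D *\<^sub>v x) $ i = (D *\<^sub>v y) $ i" if i: "i < m" for i
    proof -
      have "transpose_mat D *\<^sub>v unit_vec m i \<in> mat_Im (transpose_mat D)"
        using D unfolding mat_Im_def by auto
      with xy have "x \<bullet> (transpose_mat D *\<^sub>v unit_vec m i) = y \<bullet> (transpose_mat D *\<^sub>v unit_vec m i)"
        unfolding orth_bot_def by blast
      then have "(D *\<^sub>v x) \<bullet> unit_vec m i = (D *\<^sub>v y) \<bullet> unit_vec m i"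
        by (simp add: mult_mat_vec_transpose[OF D] c)
      then show ?thesis
        using i D c by (simp add: scalar_prod_right_unit del: index_mult_mat_vec)
    qed
    then have "D *\<^sub>v x = D *\<^sub>v y" using D by (intro eq_vecI) auto
    then show "(x, y) \<in> mat_ker D" using D c by (simp add: mat_ker_def)
  qed
qed

text \<open>Turns the intersection in conditioned invariance into a single kernel, to which the
  duality applies.\<close>

lemma mat_ker_append_rows:
  assumes "D \<in> carrier_mat m n" "C \<in> carrier_mat q n"
  shows "mat_ker (D @\<^sub>r C) = mat_ker D \<inter> mat_ker C"
proof -
  have "(D @\<^sub>r C) *\<^sub>v x = (D @\<^sub>r C) *\<^sub>v y \<longleftrightarrow> D *\<^sub>v x = D *\<^sub>v y \<and> C *\<^sub>v x = C *\<^sub>v y"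
    if "x \<in> carrier_vec n" "y \<in> carrier_vec n" for x y
    unfolding mat_mult_append[OF assms that(1)] mat_mult_append[OF assms that(2)]
    using append_vec_eq[OF mult_mat_vec_carrier mult_mat_vec_carrier] assms(1) that by blast
  moreover have "dim_col (D @\<^sub>r C) = n" "dim_col D = n" "dim_col C = n"
    using carrier_matD(2)[OF carrier_append_rows[OF assms]] assms by auto
  ultimately show ?thesis
    unfolding mat_ker_def by auto
qed

text \<open>Cutting the coefficient vector after \<open>m\<close> entries separates the rows of
  \<open>D\<close> from those of \<open>C\<close>.\<close>

lemma mat_Im_transpose_append_rows:
  assumes D: "D \<in> carrier_mat m n" and C: "C \<in> carrier_mat q n"
  shows "mat_Im (transpose_mat (D @\<^sub>r C)) \<subseteq> mat_Im (transpose_mat D) + mat_Im (transpose_mat C)"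
proof
  fix z assume "z \<in> mat_Im (transpose_mat (D @\<^sub>r C))"
  moreover have DC: "D @\<^sub>r C \<in> carrier_mat (m + q) n" using D C by auto
  ultimately obtain l where l: "l \<in> carrier_vec (m + q)" and z: "z = transpose_mat (D @\<^sub>r C) *\<^sub>v l"
    unfolding mat_Im_def by auto
  define u v where "u = vec_first l m" and "v = vec_last l q"
  have uv: "u \<in> carrier_vec m" "v \<in> carrier_vec q" "l = u @\<^sub>v v"
    using l by (auto simp: u_def v_def)
  have T: "transpose_mat D \<in> carrier_mat n m" "transpose_mat C \<in> carrier_mat n q" using D C by auto
  have zc: "z \<in> carrier_vec n" using DC l z by simp
  have "z = transpose_mat D *\<^sub>v u + transpose_mat C *\<^sub>v v"
  proof (intro eq_vecI)
    fix j assume "j < dim_vec (transpose_mat D *\<^sub>v u + transpose_mat C *\<^sub>v v)"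
    then have j: "j < n" using C by simp
    have "col (D @\<^sub>r C) j = col D j @\<^sub>v col C j"
      using j D C by (intro eq_vecI) (auto simp: append_rows_def)
    then have "z $ j = (col D j @\<^sub>v col C j) \<bullet> (u @\<^sub>v v)"
      using DC j uv by (simp add: z)
    also have "\<dots> = col D j \<bullet> u + col C j \<bullet> v"
      using D C uv by (intro scalar_prod_append[of _ m _ q]) auto
    finally show "z $ j = (transpose_mat D *\<^sub>v u + transpose_mat C *\<^sub>v v) $ j"
      using D C j by simp
  qed (use zc C in simp)
  then show "z \<in> mat_Im (transpose_mat D) + mat_Im (transpose_mat C)"
    using uv D C by (auto simp: mat_Im_def set_plus_def)
qed

lemma orth_bot_normalized_part:
  assumes K: "semimodule n K"
  shows "orth_bot n (normalized_part K) = orth_bot n K"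
proof
  show "orth_bot n K \<subseteq> orth_bot n (normalized_part K)"
    by (auto simp: orth_bot_def in_normalized_part_iff)
  show "orth_bot n (normalized_part K) \<subseteq> orth_bot n K"
  proof clarify
    fix x y assume xy: "(x, y) \<in> orth_bot n (normalized_part K)"
    then have c: "x \<in> carrier_vec n" "y \<in> carrier_vec n" by (auto simp: orth_bot_def)
    have "x \<bullet> z = y \<bullet> z" if z: "z \<in> K" for z
    proof (cases "z = 0\<^sub>v n")
      case True
      then show ?thesis using c by simp
    next
      case False
      let ?z = "normalize_vec z"
      have N: "?z \<in> normalized_part K"
        using normalize_vec_in_normalized_part[OF K z False] .
      then have "?z \<in> carrier_vec n"
        using semimoduleD(1)[OF K] by (simp add: in_normalized_part_iff)
      moreover have "x \<bullet> ?z = y \<bullet> ?z" using xy N by (auto simp: orth_bot_def)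
      ultimately have "x \<bullet> (vec_total z \<cdot>\<^sub>v ?z) = y \<bullet> (vec_total z \<cdot>\<^sub>v ?z)"
        using c by simp
      then show ?thesis
        using normalize_vec_smult[OF semimoduleD(1)[OF K z] False] by simp
    qed
    then show "(x, y) \<in> orth_bot n K" using c by (simp add: orth_bot_def)
  qed
qed

text \<open>The rows of \<open>D\<close> are the finitely many normalised vectors of
  \<open>K\<close>; by \<open>orth_bot_normalized_part\<close> they impose the same equations as all
  of \<open>K\<close>.\<close>

lemma orth_bot_eq_mat_ker:
  assumes K: "semimodule n K" and fin: "finite_volume K"
  shows "\<exists>m D. D \<in> carrier_mat m n \<and> orth_bot n K = mat_ker D"
proof -
  obtain zs where zs: "set zs = normalized_part K"
    using fin finite_list unfolding finite_volume_def by metis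
  let ?D = "mat_of_rows n zs"
  have sub: "set zs \<subseteq> carrier_vec n"
    using zs semimoduleD(1)[OF K] by (auto simp: in_normalized_part_iff)
  have "?D *\<^sub>v x = ?D *\<^sub>v y \<longleftrightarrow> (\<forall>z\<in>set zs. x \<bullet> z = y \<bullet> z)"
    if "x \<in> carrier_vec n" "y \<in> carrier_vec n" for x y
  proof -
    have "?D *\<^sub>v x = ?D *\<^sub>v y \<longleftrightarrow> (\<forall>i<length zs. zs ! i \<bullet> x = zs ! i \<bullet> y)"
      using mat_of_rows_row[OF _ subsetD[OF sub nth_mem]] by (simp add: vec_eq_iff)
    also have "\<dots> \<longleftrightarrow> (\<forall>z\<in>set zs. z \<bullet> x = z \<bullet> y)"
      by (simp add: all_set_conv_all_nth)
    also have "\<dots> \<longleftrightarrow> (\<forall>z\<in>set zs. x \<bullet> z = y \<bullet> z)"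
      using sub that by (intro ball_cong refl) (metis comm_scalar_prod subsetD)
    finally show ?thesis .
  qed
  then have "orth_bot n (set zs) = mat_ker ?D"
    by (auto simp: orth_bot_def mat_ker_def)
  then show ?thesis
    using zs orth_bot_normalized_part[OF K] mat_of_rows_carrier(1) by metis
qed

lemma congruence_mat_ker:
  assumes D: "D \<in> carrier_mat m n"
  shows "congruence n (mat_ker D)"
  unfolding congruence_def
proof (intro conjI)
  show "equiv (carrier_vec n) (mat_ker D)"
    using D by (intro equivI refl_onI symI transI) (auto simp: mat_ker_def)
  show "\<forall>(x, y)\<in>mat_ker D. \<forall>(x', y')\<in>mat_ker D. \<forall>l m. (l \<cdot>\<^sub>v x + m \<cdot>\<^sub>v x', l \<cdot>\<^sub>v y + m \<cdot>\<^sub>v y') \<in> mat_ker D"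
    using D by (auto simp: mat_ker_def mult_add_distrib_mat_vec[OF D] mult_mat_vec_smult[OF D])
qed


section \<open>The fixed point\<close>

theorem proposition5:
  fixes A C E :: "zmax mat" and n p q :: nat
    and V :: "(zmax vec \<times> zmax vec) set"
    and X :: "nat \<Rightarrow> zmax vec set"
  assumes "A \<in> carrier_mat n n"
    and "C \<in> carrier_mat q n"
    and "E \<in> carrier_mat p n"
    and "finite_volume (mat_Im E)"
    and "V = mat_ker E"
    and "X 1 = orth_top n V"
    and "\<And>k. k \<ge> 1 \<Longrightarrow>
           X (k + 1) = orth_top n V \<inter> mat_preimage (transpose_mat A) (X k + mat_Im (transpose_mat C))"
  shows "\<exists>V_fg. V_fg \<in> L_fg n C A V
              \<and> (\<forall>W \<in> L_fg n C A V. V_fg \<subseteq> W)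
              \<and> (\<exists>r. 1 \<le> r \<and> r \<le> vol (mat_Im E) + 1 \<and> V_fg = orth_bot n (X r))"
proof -
  note A = assms(1) and C = assms(2) and E = assms(3)
  note V = assms(5) and X1 = assms(6) and X_step = assms(7)
  have AT: "transpose_mat A \<in> carrier_mat n n" and CT: "transpose_mat C \<in> carrier_mat n q"
    and ET: "transpose_mat E \<in> carrier_mat n p"
    using A C E by auto
  have VT: "orth_top n V = mat_Im (transpose_mat E)"
    using orth_top_mat_ker[OF E] V by simp
  note smVT = semimodule_mat_Im[OF ET, folded VT]
  have smX: "semimodule n (X k)" if "k \<ge> 1" for k
    using that
  proof (induction k rule: nat_induct_at_least)
    case base
    show ?case using smVT X1 by simp
  next
    case (Suc k)
    then show ?case
      using X_step[of k] smVT CT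
      by (auto intro!: semimodule_Int semimodule_mat_preimage[OF AT] semimodule_plus semimodule_mat_Im)
  qed
  have X_le: "X k \<subseteq> orth_top n V" if "k \<ge> 1" for k
    using that X1 X_step by (induction k rule: nat_induct_at_least) auto
  have dec: "X (k + 1) \<subseteq> X k" if "k \<ge> 1" for k
    using that
  proof (induction k rule: nat_induct_at_least)
    case base
    show ?case using X_le[of "1 + 1"] X1 by simp
  next
    case (Suc k)
    then have "X (k + 1) + mat_Im (transpose_mat C) \<subseteq> X k + mat_Im (transpose_mat C)"
      by (intro set_plus_mono2) auto
    then show ?case
      using X_step[of k] X_step[of "Suc k"] Suc by (auto simp: mat_preimage_def)
  qed
  have finVT: "finite (normalized_part (orth_top n V))"
    and volVT: "card (normalized_part (orth_top n V)) \<le> vol (mat_Im E)"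
    using finite_volume_transpose[OF E assms(4)] VT by (auto simp: finite_volume_def vol_def)
  have fin: "finite (normalized_part (X k))" if "k \<ge> 1" for k
    using X_le[OF that] by (intro finite_subset[OF _ finVT]) (auto simp: normalized_part_def)

  have "\<exists>r. 1 \<le> r \<and> r \<le> vol (mat_Im E) + 1 \<and> X (r + 1) = X r"
  proof (rule ccontr)
    assume "\<nexists>r. 1 \<le> r \<and> r \<le> vol (mat_Im E) + 1 \<and> X (r + 1) = X r"
    then have neq: "X (k + 1) \<noteq> X k" if "1 \<le> k" "k \<le> vol (mat_Im E) + 1" for k
      using that by blast
    \<comment> \<open>Each strict decrease loses a normalised vector, and \<open>X 1\<close> has at
      most \<open>vol (mat_Im E)\<close> of them. The assumed inequalities reach index
      \<open>vol (mat_Im E) + 2\<close>, where the bound on the cardinality becomes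
      negative.\<close>
    have "k \<le> vol (mat_Im E) + 2 \<Longrightarrow> card (normalized_part (X k)) + k \<le> vol (mat_Im E) + 1"
      if "k \<ge> 1" for k
      using that
    proof (induction k rule: nat_induct_at_least)
      case base
      then show ?case using X1 volVT by simp
    next
      case (Suc k)
      have "normalized_part (X (k + 1)) \<subset> normalized_part (X k)"
        using semimodule_eqI[OF smX[of k] smX[of "k + 1"] dec] neq[of k] Suc dec[of k]
        by (auto simp: normalized_part_def)
      then have "card (normalized_part (X (k + 1))) < card (normalized_part (X k))"
        using fin[of k] Suc by (intro psubset_card_mono) auto
      then show ?case using Suc by simp
    qed
    from this[of "vol (mat_Im E) + 2"] show False by simp
  qed
  then obtain r where r: "1 \<le> r" "r \<le> vol (mat_Im E) + 1" and fix_r: "X (r + 1) = X r"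
    by auto

  have "orth_bot n (X r) \<in> L_fg n C A V"
  proof -
    obtain m D where D: "D \<in> carrier_mat m n" "orth_bot n (X r) = mat_ker D"
      using orth_bot_eq_mat_ker[OF smX[OF r(1)]] fin[OF r(1)] by (auto simp: finite_volume_def)
    have "V \<subseteq> orth_bot n (X r)"
    proof clarify
      fix x y assume xy: "(x, y) \<in> V"
      then show "(x, y) \<in> orth_bot n (X r)"
        using X_le[OF r(1)] V E by (auto simp: orth_bot_def orth_top_def mat_ker_def)
    qed
    moreover have "conditioned_invariant C A (orth_bot n (X r))"
      unfolding conditioned_invariant_def
    proof
      fix w assume "w \<in> mat_image_rel A (orth_bot n (X r) \<inter> mat_ker C)"
      then obtain x y where w: "w = (A *\<^sub>v x, A *\<^sub>v y)" and xy: "(x, y) \<in> orth_bot n (X r)"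
        and Cxy: "C *\<^sub>v x = C *\<^sub>v y"
        by (auto simp: mat_image_rel_def mat_ker_def)
      have c: "x \<in> carrier_vec n" "y \<in> carrier_vec n" using xy by (auto simp: orth_bot_def)
      have "(A *\<^sub>v x) \<bullet> z = (A *\<^sub>v y) \<bullet> z" if z: "z \<in> X r" for z
      proof -
        have zc: "z \<in> carrier_vec n" using semimoduleD(1)[OF smX[OF r(1)] z] .
        \<comment> \<open>Stationarity is used here: \<open>z\<close> lies in
          \<open>X (r + 1)\<close> as well.\<close>
        have "transpose_mat A *\<^sub>v z \<in> X r + mat_Im (transpose_mat C)"
          using z fix_r X_step[OF r(1)] by (auto simp: mat_preimage_def)
        then obtain u v where u: "u \<in> X r" and v: "v \<in> carrier_vec q"
          and eq: "transpose_mat A *\<^sub>v z = u + transpose_mat C *\<^sub>v v"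
          using C by (auto simp: mat_Im_def elim!: set_plus_elim)
        have uc: "u \<in> carrier_vec n" using semimoduleD(1)[OF smX[OF r(1)] u] .
        \<comment> \<open>The first summand agrees for \<open>x\<close> and \<open>y\<close> by
          orthogonality to \<open>X r\<close>, the second because \<open>C\<close> identifies
          them.\<close>
        have "(A *\<^sub>v x') \<bullet> z = x' \<bullet> u + (C *\<^sub>v x') \<bullet> v" if "x' \<in> carrier_vec n" for x'
        proof -
          have "(A *\<^sub>v x') \<bullet> z = x' \<bullet> (u + transpose_mat C *\<^sub>v v)"
            using mult_mat_vec_transpose[OF A that zc] eq by simp
          also have "\<dots> = x' \<bullet> u + x' \<bullet> (transpose_mat C *\<^sub>v v)"
            using that uc CT v by (intro scalar_prod_add_distrib[of _ n]) auto
          finally show ?thesis using mult_mat_vec_transpose[OF C that v] by simp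
        qed
        moreover have "x \<bullet> u = y \<bullet> u" using xy u by (auto simp: orth_bot_def)
        ultimately show ?thesis using c Cxy by simp
      qed
      then show "w \<in> orth_bot n (X r)" using w c A by (simp add: orth_bot_def)
    qed
    ultimately show ?thesis
      using D congruence_mat_ker[OF D(1)] unfolding L_fg_def by auto
  qed
  moreover have "orth_bot n (X r) \<subseteq> W" if W_in: "W \<in> L_fg n C A V" for W
  proof -
    obtain m D where D: "D \<in> carrier_mat m n" and W: "W = mat_ker D"
      using W_in by (auto simp: L_fg_def)
    have inv: "(A *\<^sub>v x, A *\<^sub>v y) \<in> W" if "(x, y) \<in> W \<inter> mat_ker C" for x y
      using W_in that by (auto simp: L_fg_def conditioned_invariant_def mat_image_rel_def)
    \<comment> \<open>Minimality is proved on the dual side: the row space of \<open>D\<close> is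
      shown to lie in every \<open>X k\<close>, and orthogonals reverse inclusions.\<close>
    let ?Y = "mat_Im (transpose_mat D)"
    have Y: "?Y = orth_top n W" using orth_top_mat_ker[OF D] W by simp
    have YV: "?Y \<subseteq> orth_top n V"
      using W_in by (auto simp: Y L_fg_def orth_top_def)
    have Y_pre: "transpose_mat A *\<^sub>v z \<in> ?Y + mat_Im (transpose_mat C)" if z: "z \<in> ?Y" for z
    proof -
      have zc: "z \<in> carrier_vec n" using z Y by (auto simp: orth_top_def)
      have "x \<bullet> (transpose_mat A *\<^sub>v z) = y \<bullet> (transpose_mat A *\<^sub>v z)"
        if xy: "(x, y) \<in> W \<inter> mat_ker C" for x y
      proof -
        have "x \<in> carrier_vec n" "y \<in> carrier_vec n" using xy C by (auto simp: mat_ker_def)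
        moreover have "(A *\<^sub>v x) \<bullet> z = (A *\<^sub>v y) \<bullet> z"
          using inv[OF xy] z Y by (auto simp: orth_top_def)
        ultimately show ?thesis by (simp add: mult_mat_vec_transpose[OF A _ zc])
      qed
      \<comment> \<open>Invariance makes this vector orthogonal to the kernel of the stacked matrix;
        duality then places it in the sum of the two row spaces.\<close>
      then have "transpose_mat A *\<^sub>v z \<in> orth_top n (mat_ker (D @\<^sub>r C))"
        using AT zc W by (auto simp: orth_top_def mat_ker_append_rows[OF D C])
      then show ?thesis
        using orth_top_mat_ker[OF carrier_append_rows[OF D C]] mat_Im_transpose_append_rows[OF D C]
        by auto
    qed
    have "?Y \<subseteq> X k" if "k \<ge> 1" for k
      using that
    proof (induction k rule: nat_induct_at_least)
      case base
      show ?case using YV X1 by simp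
    next
      case (Suc k)
      then have "?Y + mat_Im (transpose_mat C) \<subseteq> X k + mat_Im (transpose_mat C)"
        by (intro set_plus_mono2) auto
      moreover have "?Y \<subseteq> carrier_vec n" using Y by (auto simp: orth_top_def)
      ultimately show ?case
        using Y_pre YV X_step[of k] Suc AT by (auto simp: mat_preimage_def)
    qed
    then have "orth_bot n (X r) \<subseteq> orth_bot n ?Y"
      using r(1) by (fastforce simp: orth_bot_def)
    then show ?thesis using orth_bot_mat_Im[OF D] W by simp
  qed
  ultimately show ?thesis using r by blast
qed

end
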